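(* Let $X$ be an infinite-dimensional real Banach space. The following assertions are equivalent: (i) the norm on $X$ is weakly octahedral; (ii) whenever $n\in\mathbb N$, $x_1,\dotsc,x_n\in X$ and $r_1,\dotsc,r_n>0$ are such that $S_X\subset \bigcup_{i=1}^n B(x_i,r_i)$, then for every $x^\ast\in S_{X^\ast}$ one has $S_X\subset\{x\in X\colon |x^\ast(x-x_i)|\leq r_i\}$ for some $i\in\{1,\dotsc,n\}$.
   Context: $X^\ast$ is the dual space of $X$; $S_X$ and $S_{X^\ast}$ denote the unit spheres of $X$ and $X^\ast$, $B_{X^\ast}$ denotes the closed unit ball of $X^\ast$, and $B(x,r)$ denotes the closed ball in $X$ with center $x\in X$ and radius $r>0$. The norm on a Banach space $X$ is called weakly octahedral if, for every finite-dimensional subspace $E$ of $X$, every $x^\ast\in B_{X^\ast}$, and every $\varepsilon>0$, there is a $y\in S_X$ such that $\|x-y\|\geq(1-\varepsilon)\bigl(|x^\ast(x)|+\|y\|\bigr)$ for all $x\in E$. *)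

theory Defs
  imports "HOL-Analysis.Analysis"
begin

text \<open>The Banach space \<open>X\<close> is a type of class \<open>banach\<close>, and its dual is \<open>'a \<Rightarrow>\<^sub>L real\<close> with the
  operator norm. The library's \<open>dim\<close> is \<open>0\<close> on infinite-dimensional subspaces, so it cannot be used to
  express finite-dimensionality.\<close>

definition finite_dimensional :: "'a::real_vector set \<Rightarrow> bool" where
  "finite_dimensional E \<longleftrightarrow> (\<exists>B. finite B \<and> span B = E)"

definition weakly_octahedral :: "'a::real_normed_vector itself \<Rightarrow> bool" where
  "weakly_octahedral _ \<longleftrightarrow>
    (\<forall>E :: 'a set. subspace E \<and> finite_dimensional E \<longrightarrow>
      (\<forall>f :: 'a \<Rightarrow>\<^sub>L real. f \<in> cball 0 1 \<longrightarrow>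
        (\<forall>\<epsilon>::real. \<epsilon> > 0 \<longrightarrow>
          (\<exists>y \<in> sphere 0 1. \<forall>x \<in> E.
            norm (x - y) \<ge> (1 - \<epsilon>) * (\<bar>blinfun_apply f x\<bar> + norm y)))))"

end

theory Submission
  imports Defs
begin

text \<open>For a norm-one functional \<open>f\<close> the supremum of \<open>\<bar>f (z - x)\<bar>\<close> over the unit sphere is
  \<open>\<bar>f x\<bar> + 1\<close>, so (ii) says that centres \<open>x\<^sub>i\<close> and radii \<open>r\<^sub>i < \<bar>f x\<^sub>i\<bar> + 1\<close> never give a covering
  of the sphere. Thus (i) yields (ii) by taking \<open>E\<close> to be the span of the centres. Conversely, if no
  \<open>y\<close> works for \<open>E\<close>, \<open>f\<close>, \<open>\<epsilon>\<close>, then every \<open>y\<close> in the sphere has a witness \<open>x \<in> E\<close> against it, necessarily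
  in a bounded part of \<open>E\<close>; a finite net of this compact part provides a forbidden covering.
  Functionals in the ball are rescaled to norm one, except \<open>f = 0\<close>, where Riesz's lemma applies.\<close>

section \<open>Compactness of bounded parts of finite-dimensional subspaces, and their
  closedness\<close>

lemma closed_if_compact_Int_cball:
  fixes S :: "'a::real_normed_vector set"
  assumes "\<And>R. compact (S \<inter> cball 0 R)"
  shows "closed S"
proof (subst closed_sequential_limits, intro allI impI)
  fix u l assume ul: "(\<forall>n. u n \<in> S) \<and> u \<longlonglongrightarrow> l"
  then have "Bseq u"
    using convergentI convergent_imp_Bseq by blast
  then obtain K where "\<And>n. norm (u n) \<le> K"
    by (auto simp: Bseq_def)
  then have "\<forall>n. u n \<in> S \<inter> cball 0 K"
    using ul by auto
  moreover have "closed (S \<inter> cball 0 K)"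
    using assms compact_imp_closed by blast
  ultimately show "l \<in> S"
    using ul closed_sequential_limits[of "S \<inter> cball 0 K"] by blast
qed

text \<open>Induction on the spanning set. By the induction hypothesis \<open>span B\<close> is
  closed, so a new vector \<open>b\<close> outside it has positive distance \<open>d\<close> from
  it. This distance controls the coefficient of \<open>b\<close> in a bounded vector.\<close>

lemma compact_span_Int_cball:
  fixes B :: "'a::real_normed_vector set"
  assumes "finite B"
  shows "compact (span B \<inter> cball 0 R)"
  using assms
proof (induction B arbitrary: R rule: finite_induct)
  case empty
  then show ?case
    by (auto intro: finite_imp_compact)
next
  case (insert b B)
  show ?case
  proof (cases "b \<in> span B")
    case True
    then show ?thesis
      using insert.IH by (simp add: span_redundant)
  next
    case False
    let ?F = "span B"
    define d where "d = infdist b ?F"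
    have clF: "closed ?F"
      by (rule closed_if_compact_Int_cball) (rule insert.IH)
    have ne: "?F \<noteq> {}"
      using span_zero by blast
    have d: "d > 0"
      unfolding d_def using infdist_pos_not_in_closed[OF clF ne False] .
    \<comment> \<open>For nonzero \<open>t\<close> the vector is \<open>t\<close> times the
      difference of \<open>b\<close> and a point of the span.\<close>
    have coeff: "\<bar>t\<bar> * d \<le> norm (x + t *\<^sub>R b)" if x: "x \<in> ?F" for x t
    proof (cases "t = 0")
      case False
      have "(- (1 / t)) *\<^sub>R x \<in> ?F"
        using x span_scale by blast
      then have "d \<le> norm (b - (- (1 / t)) *\<^sub>R x)"
        unfolding d_def dist_norm[symmetric] by (rule infdist_le)
      moreover have "x + t *\<^sub>R b = t *\<^sub>R (b - (- (1 / t)) *\<^sub>R x)"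
        using False by (simp add: algebra_simps)
      ultimately show ?thesis
        by (metis abs_ge_zero mult_left_mono norm_scaleR)
    qed simp
    let ?T = "R / d"
    let ?C = "(?F \<inter> cball 0 (R + ?T * norm b)) \<times> {- ?T .. ?T}"
    let ?h = "\<lambda>p. fst p + snd p *\<^sub>R b"
    have "compact (?h ` ?C)"
      by (intro compact_continuous_image compact_Times insert.IH continuous_intros compact_Icc)
    \<comment> \<open>The image of the compact box may stick out of the ball, so it is cut by the
      ball again.\<close>
    moreover have "span (insert b B) \<inter> cball 0 R = ?h ` ?C \<inter> cball 0 R"
    proof (intro equalityI subsetI)
      fix y assume y: "y \<in> span (insert b B) \<inter> cball 0 R"
      then obtain t where t: "y - t *\<^sub>R b \<in> ?F"
        by (auto simp: span_insert)
      let ?x = "y - t *\<^sub>R b"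
      have "\<bar>t\<bar> * d \<le> R"
        using coeff[OF t, of t] y by simp
      then have tT: "\<bar>t\<bar> \<le> ?T"
        using d by (simp add: field_simps)
      have "norm ?x \<le> norm y + \<bar>t\<bar> * norm b"
        by (metis norm_scaleR norm_triangle_ineq4)
      also have "\<dots> \<le> R + ?T * norm b"
        using y tT by (intro add_mono mult_right_mono) auto
      finally have "(?x, t) \<in> ?C"
        using t tT by auto
      then have "y \<in> ?h ` ?C"
        by (rule rev_image_eqI) simp
      then show "y \<in> ?h ` ?C \<inter> cball 0 R"
        using y by blast
    next
      fix y assume y: "y \<in> ?h ` ?C \<inter> cball 0 R"
      then obtain v t where "v \<in> ?F" "y = v + t *\<^sub>R b"
        by fastforce
      then have "y \<in> span (insert b B)"
        by (auto simp: span_insert intro!: exI[of _ t])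
      then show "y \<in> span (insert b B) \<inter> cball 0 R"
        using y by blast
    qed
    ultimately show ?thesis
      by (simp add: compact_Int_closed)
  qed
qed

section \<open>Unit vectors almost at distance one from a proper closed subspace\<close>

lemma riesz_lemma:
  fixes E :: "'a::real_normed_vector set"
  assumes E: "subspace E" "closed E" "E \<noteq> UNIV" and c: "c < 1"
  obtains y where "norm y = 1" "\<And>x. x \<in> E \<Longrightarrow> c \<le> norm (x - y)"
proof -
  obtain b where b: "b \<notin> E"
    using E by blast
  define d where "d = infdist b E"
  have ne: "E \<noteq> {}"
    using subspace_0[OF E(1)] by blast
  have d: "d > 0"
    unfolding d_def using infdist_pos_not_in_closed[OF E(2) ne b] .
  \<comment> \<open>\<open>c\<close> may be zero or negative; \<open>k\<close> can safely be divided
    by.\<close>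
  define k where "k = max c (1/2)"
  have k: "0 < k" "k < 1" "c \<le> k"
    using c by (auto simp: k_def)
  have "d < d / k"
    using d k by (simp add: field_simps)
  then have "(INF a\<in>E. dist b a) < d / k"
    using ne by (simp add: d_def infdist_notempty)
  then obtain e where e: "e \<in> E" "dist b e < d / k"
    using ne by (subst (asm) cINF_less_iff) auto
  define s where "s = norm (b - e)"
  have s: "s > 0" "k * s < d"
    using e b k by (auto simp: s_def dist_norm field_simps)
  define y where "y = (1 / s) *\<^sub>R (b - e)"
  show ?thesis
  proof
    show "norm y = 1"
      using s by (simp add: y_def s_def)
    fix x assume x: "x \<in> E"
    \<comment> \<open>Scaling by \<open>s\<close> turns the distance from \<open>y\<close> to
      \<open>x\<close> into that from \<open>b\<close> to a point of \<open>E\<close>, hence at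
      least \<open>d > k * s\<close>.\<close>
    have "e + s *\<^sub>R x \<in> E"
      using x e E(1) by (simp add: subspace_add subspace_scale)
    then have "d \<le> norm (b - (e + s *\<^sub>R x))"
      unfolding d_def dist_norm[symmetric] by (rule infdist_le)
    also have "b - (e + s *\<^sub>R x) = - (s *\<^sub>R (x - y))"
      using s by (simp add: y_def algebra_simps)
    also have "norm \<dots> = s * norm (x - y)"
      using s by simp
    finally have "k * s < s * norm (x - y)"
      using s by linarith
    then have "k < norm (x - y)"
      using s by (simp add: mult.commute)
    then show "c \<le> norm (x - y)"
      using k by simp
  qed
qed

section \<open>Functionals on the unit sphere\<close>

lemma nonzero_vector_if_blinfun_nonzero:
  fixes f :: "'a::real_normed_vector \<Rightarrow>\<^sub>L real"
  assumes "f \<noteq> 0"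
  shows "\<exists>w :: 'a. w \<noteq> 0"
proof -
  have "\<exists>w. f w \<noteq> 0"
    using assms by (auto intro: blinfun_eqI)
  then show ?thesis
    by (metis blinfun.zero_right)
qed

text \<open>Applying the bound to both \<open>z\<close> and \<open>- z\<close> gives \<bar>f z\<bar>
  + \<bar>f x\<bar> \<le> r; the supremum of \<bar>f z\<bar> over the sphere is
  \<open>norm f\<close>. A nonzero vector is needed to exclude an empty sphere.\<close>

lemma abs_blinfun_translate_sphere_bound:
  fixes f :: "'a::real_normed_vector \<Rightarrow>\<^sub>L real"
  assumes f: "norm f = 1" and bound: "\<And>z. norm z = 1 \<Longrightarrow> \<bar>f (z - x)\<bar> \<le> r"
  shows "\<bar>f x\<bar> + 1 \<le> r"
proof -
  have sph: "\<bar>f z\<bar> \<le> r - \<bar>f x\<bar>" if "norm z = 1" for z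
    using bound[of z] bound[of "- z"] that by (simp add: blinfun.diff_right blinfun.minus_right)
  obtain w :: 'a where w: "w \<noteq> 0"
    using f nonzero_vector_if_blinfun_nonzero[of f] by fastforce
  have "norm f \<le> r - \<bar>f x\<bar>"
  proof (rule norm_blinfun_bound)
    have "norm (sgn w) = 1"
      using w by (simp add: norm_sgn)
    then show "0 \<le> r - \<bar>f x\<bar>"
      using sph[of "sgn w"] by linarith
    fix v
    show "norm (f v) \<le> (r - \<bar>f x\<bar>) * norm v"
    proof (cases "v = 0")
      case False
      then have "\<bar>f (sgn v)\<bar> \<le> r - \<bar>f x\<bar>"
        by (intro sph) (simp add: norm_sgn)
      then show ?thesis
        using False by (simp add: sgn_div_norm blinfun.scaleR_right abs_mult field_simps)
    qed (simp add: blinfun.zero_right)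
  qed
  then show ?thesis
    using f by simp
qed

section \<open>The two implications\<close>

theorem proposition3p4:
  assumes "\<not> finite_dimensional (UNIV :: 'a::banach set)"
  shows "weakly_octahedral TYPE('a) \<longleftrightarrow>
    (\<forall>(n::nat) (x :: nat \<Rightarrow> 'a) (r :: nat \<Rightarrow> real).
      n \<ge> 1 \<and> (\<forall>i \<in> {1..n}. r i > 0) \<and> sphere 0 1 \<subseteq> (\<Union>i \<in> {1..n}. cball (x i) (r i)) \<longrightarrow>
      (\<forall>f :: 'a \<Rightarrow>\<^sub>L real. f \<in> sphere 0 1 \<longrightarrow>
        (\<exists>i \<in> {1..n}. sphere 0 1 \<subseteq> {z. \<bar>blinfun_apply f (z - x i)\<bar> \<le> r i})))"
    (is "?L \<longleftrightarrow> ?R")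
proof
  assume L: ?L
  show ?R
  proof (intro allI impI, elim conjE, rule ccontr)
    fix n :: nat and x :: "nat \<Rightarrow> 'a" and r :: "nat \<Rightarrow> real" and f :: "'a \<Rightarrow>\<^sub>L real"
    assume n: "n \<ge> 1" and r: "\<forall>i \<in> {1..n}. r i > 0"
      and cover: "sphere 0 1 \<subseteq> (\<Union>i \<in> {1..n}. cball (x i) (r i))"
      and f: "f \<in> sphere 0 1"
      and not_ex: "\<not> (\<exists>i \<in> {1..n}. sphere 0 1 \<subseteq> {z. \<bar>f (z - x i)\<bar> \<le> r i})"
    have less: "r i < \<bar>f (x i)\<bar> + 1" if i: "i \<in> {1..n}" for i
    proof -
      obtain z where z: "norm z = 1" "r i < \<bar>f (z - x i)\<bar>"
        using not_ex i by (fastforce simp: subset_eq not_le)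
      have "\<bar>f z\<bar> \<le> 1"
        using norm_blinfun[of f z] f z by simp
      then show ?thesis
        using z by (simp add: blinfun.diff_right)
    qed
    \<comment> \<open>Finitely many ratios below 1 have a maximum \<open>m\<close> below 1, and
      \<epsilon> is chosen so that 1 - \<epsilon> lies halfway between \<open>m\<close> and
      1.\<close>
    define q where "q i = r i / (\<bar>f (x i)\<bar> + 1)" for i
    define m where "m = Max (q ` {1..n})"
    have "q i < 1" if "i \<in> {1..n}" for i
      using less[OF that] by (simp add: q_def)
    then have "m < 1"
      using n by (simp add: m_def)
    define \<epsilon> where "\<epsilon> = (1 - m) / 2"
    have "\<epsilon> > 0" "1 - \<epsilon> > m"
      using \<open>m < 1\<close> by (auto simp: \<epsilon>_def field_simps)
    have "finite_dimensional (span (x ` {1..n}))"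
      unfolding finite_dimensional_def by blast
    then obtain y where y: "norm y = 1"
      and far: "\<forall>v \<in> span (x ` {1..n}). norm (v - y) \<ge> (1 - \<epsilon>) * (\<bar>f v\<bar> + norm y)"
      using L f \<open>\<epsilon> > 0\<close> unfolding weakly_octahedral_def
      by (metis subspace_span mem_sphere_0 mem_cball_0 order_refl)
    obtain i where i: "i \<in> {1..n}" "norm (x i - y) \<le> r i"
      using cover y by (fastforce simp: dist_norm subset_eq)
    have "q i \<le> m"
      unfolding m_def using i(1) by (intro Max_ge) auto
    then have "q i < 1 - \<epsilon>"
      using \<open>1 - \<epsilon> > m\<close> by linarith
    then have "r i < (1 - \<epsilon>) * (\<bar>f (x i)\<bar> + 1)"
      by (simp add: q_def pos_divide_less_eq)
    moreover have "x i \<in> span (x ` {1..n})"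
      using i(1) by (simp add: span_base)
    ultimately show False
      using far y i(2) by fastforce
  qed
next
  assume R: ?R
  have key: "\<exists>y. norm y = 1 \<and> (\<forall>x \<in> E. norm (x - y) \<ge> (1 - \<epsilon>) * (\<bar>f x\<bar> + 1))"
    if fd: "finite_dimensional E" and f: "norm f = 1" and \<epsilon>: "0 < \<epsilon>" "\<epsilon> < 1"
    for E and f :: "'a \<Rightarrow>\<^sub>L real" and \<epsilon> :: real
  proof (rule ccontr)
    assume contra: "\<not> ?thesis"
    have f_le: "\<bar>f v\<bar> \<le> norm v" for v
      using norm_blinfun[of f v] f by simp
    \<comment> \<open>A witness \<open>v\<close> satisfies norm v - 1 \<le> (1 - \<epsilon>) * (norm
      v + 1), hence norm v \<le> M. Replacing it by a net point costs at most \<delta> in the norm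
      and \<delta> in the value of \<open>f\<close>; the total \<epsilon> / 2 is absorbed by
      weakening the factor to 1 - \<epsilon> / 2 in \<rho>, because \<bar>f k\<bar> + 1 \<ge>
      1.\<close>
    define M where "M = 2 / \<epsilon>"
    define \<delta> where "\<delta> = \<epsilon> / 4"
    have \<delta>: "\<delta> > 0"
      using \<epsilon> by (simp add: \<delta>_def)
    have cpt: "compact (E \<inter> cball 0 M)"
      using fd compact_span_Int_cball unfolding finite_dimensional_def by blast
    then obtain K where K: "finite K" "E \<inter> cball 0 M \<subseteq> (\<Union>k\<in>K. ball k \<delta>)"
      using \<delta> unfolding compact_eq_totally_bounded by blast
    define \<rho> where "\<rho> k = (1 - \<epsilon> / 2) * (\<bar>f k\<bar> + 1)" for k
    have cov: "\<exists>k\<in>K. norm (k - y) \<le> \<rho> k" if y: "norm y = 1" for y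
    proof -
      obtain v where v: "v \<in> E" "norm (v - y) < (1 - \<epsilon>) * (\<bar>f v\<bar> + 1)"
        using contra y by (auto simp: not_le)
      have "norm v - 1 \<le> norm (v - y)"
        using norm_triangle_ineq2[of v y] y by simp
      also have "\<dots> \<le> (1 - \<epsilon>) * (norm v + 1)"
        using v(2) f_le[of v] \<epsilon> by (smt (verit) mult_left_mono)
      finally have "\<epsilon> * norm v \<le> 2"
        using \<epsilon> by (simp add: algebra_simps)
      then have "v \<in> E \<inter> cball 0 M"
        using v(1) \<epsilon> by (simp add: M_def field_simps)
      then obtain k where k: "k \<in> K" "norm (k - v) < \<delta>"
        using K(2) by (auto simp: dist_norm)
      have "\<bar>f v\<bar> \<le> \<bar>f k\<bar> + \<delta>"
        using f_le[of "k - v"] k(2) by (simp add: blinfun.diff_right)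
      then have "(1 - \<epsilon>) * (\<bar>f v\<bar> + 1) \<le> (1 - \<epsilon>) * (\<bar>f k\<bar> + \<delta> + 1)"
        using \<epsilon> by (intro mult_left_mono) auto
      also have "\<dots> \<le> (1 - \<epsilon>) * (\<bar>f k\<bar> + 1) + \<delta>"
        using \<epsilon> \<delta> by (simp add: algebra_simps)
      finally have "norm (k - y) \<le> (1 - \<epsilon>) * (\<bar>f k\<bar> + 1) + 2 * \<delta>"
        using norm_triangle_ineq[of "k - v" "v - y"] k(2) v(2) by simp
      also have "\<dots> \<le> \<rho> k"
        using \<epsilon> by (simp add: \<rho>_def \<delta>_def algebra_simps)
      finally show ?thesis
        using k(1) by blast
    qed
    obtain x where x: "bij_betw x {1..card K} K"
      using ex_bij_betw_nat_finite_1[OF K(1)] by blast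
    \<comment> \<open>(ii) asks for at least one ball; the net has a point because some unit vector
      has to be covered.\<close>
    have "K \<noteq> {}"
    proof -
      obtain w :: 'a where "w \<noteq> 0"
        using f nonzero_vector_if_blinfun_nonzero[of f] by fastforce
      then show ?thesis
        using cov[of "sgn w"] by (auto simp: norm_sgn)
    qed
    then have "card K \<ge> 1"
      using K(1) by (simp add: Suc_le_eq card_gt_0_iff)
    moreover have "\<rho> k > 0" for k
      using \<epsilon> by (simp add: \<rho>_def add_nonneg_pos)
    moreover have "sphere 0 1 \<subseteq> (\<Union>i \<in> {1..card K}. cball (x i) (\<rho> (x i)))"
    proof
      fix y :: 'a assume "y \<in> sphere 0 1"
      then obtain k where k: "k \<in> K" "norm (k - y) \<le> \<rho> k"
        using cov by auto
      have "k \<in> x ` {1..card K}"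
        using k(1) x by (simp add: bij_betw_def)
      then obtain i where "i \<in> {1..card K}" "k = x i"
        by (rule imageE)
      then show "y \<in> (\<Union>i \<in> {1..card K}. cball (x i) (\<rho> (x i)))"
        using k(2) by (auto simp: dist_norm intro!: bexI[of _ i])
    qed
    ultimately obtain i where i: "sphere 0 1 \<subseteq> {z. \<bar>f (z - x i)\<bar> \<le> \<rho> (x i)}"
      using R[rule_format, of "card K" "\<lambda>i. \<rho> (x i)" x f] f by auto
    have "\<bar>f (x i)\<bar> + 1 \<le> \<rho> (x i)"
      using i by (intro abs_blinfun_translate_sphere_bound f) auto
    then have "(\<epsilon> / 2) * (\<bar>f (x i)\<bar> + 1) \<le> 0"
      by (simp add: \<rho>_def algebra_simps)
    then show False
      using \<epsilon> by (simp add: mult_le_0_iff)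
  qed
  show ?L
    unfolding weakly_octahedral_def
  proof (intro allI impI, elim conjE)
    fix E :: "'a set" and f :: "'a \<Rightarrow>\<^sub>L real" and \<epsilon> :: real
    assume E: "subspace E" "finite_dimensional E" and f: "f \<in> cball 0 1" and "\<epsilon> > 0"
    \<comment> \<open>\<open>key\<close> needs a parameter below 1; a smaller parameter gives a
      stronger inequality.\<close>
    define \<eta> where "\<eta> = min \<epsilon> (1/2)"
    have \<eta>: "0 < \<eta>" "\<eta> < 1" "\<eta> \<le> \<epsilon>"
      using \<open>\<epsilon> > 0\<close> by (auto simp: \<eta>_def)
    have "\<exists>y. norm y = 1 \<and> (\<forall>x \<in> E. norm (x - y) \<ge> (1 - \<eta>) * (\<bar>f x\<bar> + 1))"
    proof (cases "f = 0")
      case True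
      \<comment> \<open>For \<open>f = 0\<close> only 1 - \<eta> \<le> norm (x - y) is required.
        Infinite dimension of the space makes \<open>E\<close> proper.\<close>
      have "closed E"
        using E(2) closed_if_compact_Int_cball compact_span_Int_cball
        unfolding finite_dimensional_def by metis
      moreover have "E \<noteq> UNIV"
        using E(2) assms by blast
      moreover have "1 - \<eta> < 1"
        using \<eta> by simp
      ultimately obtain y where "norm y = 1" "\<And>x. x \<in> E \<Longrightarrow> 1 - \<eta> \<le> norm (x - y)"
        using riesz_lemma[OF E(1)] by blast
      then show ?thesis
        using True by auto
    next
      case False
      define g where "g = (1 / norm f) *\<^sub>R f"
      have "norm g = 1"
        using False by (simp add: g_def)
      then obtain y where y: "norm y = 1" "\<forall>x \<in> E. norm (x - y) \<ge> (1 - \<eta>) * (\<bar>g x\<bar> + 1)"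
        using key[OF E(2) _ \<eta>(1,2)] by blast
      \<comment> \<open>As norm f \<le> 1, normalising only enlarges the values, so the
        \<open>y\<close> found for \<open>g\<close> serves \<open>f\<close>.\<close>
      have "\<bar>f x\<bar> \<le> \<bar>g x\<bar>" for x
      proof -
        have "\<bar>f x\<bar> = norm f * \<bar>g x\<bar>"
          using False by (simp add: g_def blinfun.scaleR_left abs_mult)
        also have "\<dots> \<le> \<bar>g x\<bar>"
          using f by (simp add: mult_left_le_one_le)
        finally show ?thesis .
      qed
      then have "(1 - \<eta>) * (\<bar>f x\<bar> + 1) \<le> (1 - \<eta>) * (\<bar>g x\<bar> + 1)" for x
        using \<eta> by (intro mult_left_mono) auto
      then show ?thesis
        using y by (meson order_trans)
    qed
    then obtain y where y: "norm y = 1" "\<forall>x \<in> E. norm (x - y) \<ge> (1 - \<eta>) * (\<bar>f x\<bar> + 1)"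
      by blast
    have le: "(1 - \<epsilon>) * (\<bar>f x\<bar> + 1) \<le> (1 - \<eta>) * (\<bar>f x\<bar> + 1)" for x
      using \<eta> by (intro mult_right_mono) auto
    show "\<exists>y \<in> sphere 0 1. \<forall>x \<in> E. norm (x - y) \<ge> (1 - \<epsilon>) * (\<bar>f x\<bar> + norm y)"
    proof (intro bexI[of _ y] ballI)
      fix x assume "x \<in> E"
      then have "(1 - \<eta>) * (\<bar>f x\<bar> + 1) \<le> norm (x - y)"
        using y by blast
      then show "norm (x - y) \<ge> (1 - \<epsilon>) * (\<bar>f x\<bar> + norm y)"
        using le[of x] y(1) by simp
    qed (use y in simp)
  qed
qed

end
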